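(* For a Banach space $Y$ the following assertions are equivalent: (1) $Y$ is finite-dimensional. (2) The sequence $(T_k^\omega)_{k\ge1}$ of countably branching trees of height $k$ does not equi-coarsely embed into $Y$.
   Context: All Banach spaces are real; $\mathbb N=\{1,2,\dots\}$. $[\mathbb N]^{\le k}$ is the set of subsets of $\mathbb N$ of cardinality at most $k$ (including $\emptyset$), with elements listed in increasing order. The tree metric is $d_T(\bar m,\bar n)=|\bar m|+|\bar n|-2|\bar m\wedge\bar n|$, where $\bar m\wedge\bar n$ is the longest common initial segment of $\bar m$ and $\bar n$. $T_k^\omega$ is the metric space $([\mathbb N]^{\le k},d_T)$; $d_T$ is the graph metric of the countably branching tree of height $k$ (each $\bar m$ adjacent to its immediate one-element extensions). For a map $f:(X,d_X)\to(Y,d_Y)$ between metric spaces put $\rho_f(t)=\inf\{d_Y(f(x),f(y)): d_X(x,y)\ge t\}$ and $\omega_f(t)=\sup\{d_Y(f(x),f(y)): d_X(x,y)\le t\}$, with $\inf\emptyset=+\infty$, $\sup\emptyset=0$. A family $(X_i)_{i\in I}$ of metric spaces equi-coarsely embeds into $Y$ if there exist non-decreasing functions $\rho,\omega:[0,\infty)\to[0,\infty)$ with $\lim_{t\to\infty}\rho(t)=\infty$ and maps $f_i:X_i\to Y$ such that $\rho\le\rho_{f_i}$ and $\omega_{f_i}\le\omega$ for all $i\in I$. *)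

theory Defs
  imports "HOL-Analysis.Analysis" "HOL-Library.Sublist"
begin

section \<open>Countably branching trees\<close>

definition tree_meet :: "nat set \<Rightarrow> nat set \<Rightarrow> nat set"  (infixl \<open>\<and>\<^sub>T\<close> 70) where
  "m \<and>\<^sub>T n = set (longest_common_prefix (sorted_list_of_set m) (sorted_list_of_set n))"

definition tree_dist :: "nat set \<Rightarrow> nat set \<Rightarrow> real" where
  "tree_dist m n = real (card m) + real (card n) - 2 * real (card (m \<and>\<^sub>T n))"

text \<open>The natural numbers start at 1 here, hence \<open>{1..}\<close>.\<close>

definition nat_subsets_le :: "nat \<Rightarrow> nat set set" where
  "nat_subsets_le k = {m. m \<subseteq> {1..} \<and> finite m \<and> card m \<le> k}"

definition branching_tree :: "nat \<Rightarrow> nat set metric" where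
  "branching_tree k = metric (nat_subsets_le k, tree_dist)"

text \<open>
  The constructor \<open>metric\<close> is only meaningful on actual metric spaces, so the
  following lemmas are what makes \<open>branching_tree\<close> the intended object.
\<close>

lemma card_tree_meet:
  "card (m \<and>\<^sub>T n)
    = length (longest_common_prefix (sorted_list_of_set m) (sorted_list_of_set n))"
proof -
  have "distinct (longest_common_prefix (sorted_list_of_set m) (sorted_list_of_set n))"
    using longest_common_prefix_prefix1[of "sorted_list_of_set m" "sorted_list_of_set n"]
    by (metis distinct_append distinct_sorted_list_of_set prefix_def)
  then show ?thesis
    by (simp add: tree_meet_def distinct_card)
qed

lemma longest_common_prefix_commute:
  "longest_common_prefix xs ys = longest_common_prefix ys xs"
  by (induction xs ys rule: longest_common_prefix.induct) auto

lemma length_longest_common_prefix_le1: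
  "length (longest_common_prefix xs ys) \<le> length xs"
  by (simp add: longest_common_prefix_prefix1 prefix_length_le)

lemma length_longest_common_prefix_le2:
  "length (longest_common_prefix xs ys) \<le> length ys"
  by (simp add: longest_common_prefix_prefix2 prefix_length_le)

lemma longest_common_prefix_ultrametric:
  "min (length (longest_common_prefix xs ys)) (length (longest_common_prefix ys zs))
    \<le> length (longest_common_prefix xs zs)"
proof (induction xs ys arbitrary: zs rule: longest_common_prefix.induct)
  case (1 x xs y ys)
  then show ?case
  proof (cases zs)
    case (Cons z zs')
    then show ?thesis
      using 1[of zs'] by auto
  qed simp
qed auto

lemma Metric_space_tree: "Metric_space (nat_subsets_le k) tree_dist"
proof
  fix m n p :: "nat set"
  let ?L = sorted_list_of_set
  let ?c = "\<lambda>m n. length (longest_common_prefix (?L m) (?L n))"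
  have le: "?c m n \<le> card m" "?c m n \<le> card n" for m n
    using length_longest_common_prefix_le1[of "?L m" "?L n"]
      length_longest_common_prefix_le2[of "?L m" "?L n"] by simp_all
  show "0 \<le> tree_dist m n"
    using le[of m n] by (simp add: tree_dist_def card_tree_meet)
  show "tree_dist m n = tree_dist n m"
    by (simp add: tree_dist_def card_tree_meet longest_common_prefix_commute)
  show "tree_dist m n = 0 \<longleftrightarrow> m = n" if mn: "m \<in> nat_subsets_le k" "n \<in> nat_subsets_le k"
  proof
    assume "tree_dist m n = 0"
    with le[of m n] have eq: "?c m n = length (?L m)" "?c m n = length (?L n)"
      by (simp_all add: tree_dist_def card_tree_meet)
    then have "?L m = ?L n"
      by (metis longest_common_prefix_prefix1 longest_common_prefix_prefix2
          prefix_def append_eq_conv_conj take_all le_refl)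
    then show "m = n"
      using mn by (metis (mono_tags, lifting) mem_Collect_eq nat_subsets_le_def
          sorted_list_of_set.set_sorted_key_list_of_set)
  next
    have "longest_common_prefix xs xs = xs" for xs :: "nat list"
      by (induction xs) auto
    moreover assume "m = n"
    ultimately show "tree_dist m n = 0"
      by (simp add: tree_dist_def card_tree_meet)
  qed
  have "min (?c m n) (?c n p) \<le> ?c m p"
    by (rule longest_common_prefix_ultrametric)
  then show "tree_dist m p \<le> tree_dist m n + tree_dist n p"
    using le[of m n] le[of n p] by (simp add: tree_dist_def card_tree_meet min_def split: if_splits)
qed

lemma mspace_branching_tree [simp]: "mspace (branching_tree k) = nat_subsets_le k"
  by (simp add: branching_tree_def Metric_space.mspace_metric Metric_space_tree)

lemma mdist_branching_tree [simp]: "mdist (branching_tree k) = tree_dist"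
  by (simp add: branching_tree_def Metric_space.mdist_metric Metric_space_tree)


section \<open>Coarse embeddings\<close>

text \<open>
  The moduli take values in \<open>ennreal\<close>, where \<open>Inf {} = \<infinity>\<close> and \<open>Sup {} = 0\<close>.
\<close>

definition compression_modulus ::
    "'a metric \<Rightarrow> 'b metric \<Rightarrow> ('a \<Rightarrow> 'b) \<Rightarrow> real \<Rightarrow> ennreal" where
  "compression_modulus X Y f t =
    Inf {ennreal (mdist Y (f x) (f y)) | x y. x \<in> mspace X \<and> y \<in> mspace X \<and> mdist X x y \<ge> t}"

definition expansion_modulus ::
    "'a metric \<Rightarrow> 'b metric \<Rightarrow> ('a \<Rightarrow> 'b) \<Rightarrow> real \<Rightarrow> ennreal" where
  "expansion_modulus X Y f t =
    Sup {ennreal (mdist Y (f x) (f y)) | x y. x \<in> mspace X \<and> y \<in> mspace X \<and> mdist X x y \<le> t}"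

definition equi_coarsely_embeds :: "'i set \<Rightarrow> ('i \<Rightarrow> 'a metric) \<Rightarrow> 'b metric \<Rightarrow> bool" where
  "equi_coarsely_embeds I X Y \<longleftrightarrow>
    (\<exists>\<rho> \<omega> :: real \<Rightarrow> real. \<exists>f :: 'i \<Rightarrow> 'a \<Rightarrow> 'b.
      \<rho> \<in> {0..} \<rightarrow> {0..} \<and> mono_on {0..} \<rho> \<and>
      \<omega> \<in> {0..} \<rightarrow> {0..} \<and> mono_on {0..} \<omega> \<and>
      filterlim \<rho> at_top at_top \<and>
      (\<forall>i\<in>I. f i \<in> mspace (X i) \<rightarrow> mspace Y \<and>
        (\<forall>t\<ge>0. ennreal (\<rho> t) \<le> compression_modulus (X i) Y (f i) t \<and>
               expansion_modulus (X i) Y (f i) t \<le> ennreal (\<omega> t))))"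

end

theory Submission
  imports Defs "HOL-Library.Ramsey" "HOL-Library.Nat_Bijection"
begin

text \<open>
  Infinitely many disjoint branches of length \<open>K\<close> end in nodes at distance \<open>K\<close> from the root and
  \<open>2 * K\<close> from each other. A coarse embedding would map them, for large \<open>K\<close>, to a bounded separated
  sequence, and a finite-dimensional space has none
  (\<open>not_equi_coarsely_embeds_finite_span\<close>).

  Conversely, an infinite-dimensional space contains a sequence \<open>y\<close> of unit vectors at mutual
  distance at least \<open>1/2\<close>. The tree is embedded by attaching vectors built from \<open>y\<close> to its
  nodes and summing them, with suitable coefficients, along the branch that leads to a node. Which
  coefficients work depends on the size of the sums \<open>\<plusminus> y n\<^sub>1 \<plusminus> \<dots> \<plusminus> y n\<^sub>N\<close>.

  If such sums of signs are large for all long sign patterns, up to passing to subsequences, all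
  coefficients can be \<open>1\<close>: two nodes have images whose difference is a sum of signs with as many
  terms as their distance (\<open>embeddings_if_sign_sums_unbounded\<close>). This is the embedding of the tree
  into \<open>l1\<close>.

  Otherwise, arbitrarily long sign patterns have uniformly bounded sums along some infinite set of
  positions. Moving some of the positions shows that the differences \<open>z\<close> of consecutive vectors
  have bounded sums for all initial parts of the sign pattern
  (\<open>norm_sign_difference_sum_le\<close>). Moreover, differences in a subsequence have
  bounded coordinates: averaging the other terms over many consecutive differences makes them
  telescope, while the term in question does not change
  (\<open>exists_large_difference_sum\<close>). So \<open>z\<close> resembles the unit vectors of \<open>c0\<close>, and the tree embeds
  as into \<open>c0\<close>: coefficients that decrease linearly along the branch, from the length of the branch
  down to \<open>1\<close> and multiplied by the signs of the pattern, change by a bounded vector in every step, and the large first coefficients beyond the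
  meet separate distant nodes (\<open>embeddings_if_sign_sums_bounded\<close>).

  In both cases Ramsey's theorem makes the required lower bounds hold for all choices of positions in
  one infinite set. For a fixed height only finitely many coefficient patterns occur, so
  finitely many applications suffice, and the constants do not depend on the height.
\<close>

section \<open>Compactness in finite-dimensional subspaces\<close>

lemma closed_if_compact_Int_cball:
  fixes S :: "'b::real_normed_vector set"
  assumes S: "\<And>r. compact (cball 0 r \<inter> S)"
  shows "closed S"
  unfolding closed_sequential_limits
proof (intro allI impI, elim conjE)
  fix f :: "nat \<Rightarrow> 'b" and l
  assume f: "\<forall>n. f n \<in> S" and lim: "f \<longlonglongrightarrow> l"
  from lim have "Bseq f" by (meson convergentI convergent_imp_Bseq)
  then obtain K where K: "\<And>n. norm (f n) \<le> K" unfolding Bseq_def by blast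
  have "closed (cball 0 K \<inter> S)" by (rule compact_imp_closed[OF S])
  moreover have "\<forall>n. f n \<in> cball 0 K \<inter> S" using f K by auto
  ultimately have "l \<in> cball 0 K \<inter> S" using lim by (metis closed_sequentially)
  then show "l \<in> S" by simp
qed

text \<open>
  With \<open>d > 0\<close> the distance from \<open>x\<close> to the closed subspace \<open>span B\<close>, one has
  \<open>\<bar>t\<bar> * d \<le> norm (t *\<^sub>R x + s)\<close> for \<open>s \<in> span B\<close>. Hence the coordinates \<open>t\<close> and \<open>s\<close> of a vector of the
  ball are bounded, and the ball is a closed part of a continuous image of a compact product.
\<close>

lemma compact_cball_span_insert:
  fixes x :: "'b::real_normed_vector"
  assumes S: "\<And>r. compact (cball 0 r \<inter> span B)" and x: "x \<notin> span B"
  shows "compact (cball 0 r \<inter> span (insert x B))"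
proof -
  have clS: "closed (span B)" using S by (rule closed_if_compact_Int_cball)
  define d where "d = infdist x (span B)"
  have d: "d > 0"
    using infdist_pos_not_in_closed[OF clS _ x] span_zero d_def by blast
  have coeff: "\<bar>t\<bar> * d \<le> norm (t *\<^sub>R x + s)" if "s \<in> span B" for t s
  proof (cases "t = 0")
    case False
    have "- ((1/t) *\<^sub>R s) \<in> span B" using that by (simp add: span_scale span_neg)
    then have "d \<le> dist x (- ((1/t) *\<^sub>R s))" unfolding d_def by (rule infdist_le)
    then have "d \<le> norm (x + (1/t) *\<^sub>R s)" by (simp add: dist_norm)
    then have "\<bar>t\<bar> * d \<le> norm (t *\<^sub>R (x + (1/t) *\<^sub>R s))"
      by (simp add: mult_left_mono)
    then show ?thesis using False by (simp add: scaleR_add_right)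
  qed simp
  define T where "T = \<bar>r\<bar> / d"
  let ?K = "(\<lambda>(t, s). t *\<^sub>R x + s) ` ({-T..T} \<times> (cball 0 (\<bar>r\<bar> + T * norm x) \<inter> span B))"
  have "compact ?K"
    by (intro compact_continuous_image compact_Times S compact_Icc)
       (auto simp: case_prod_unfold intro!: continuous_intros)
  moreover have "cball 0 r \<inter> span (insert x B) = cball 0 r \<inter> ?K"
  proof (intro equalityI subsetI)
    fix v assume v: "v \<in> cball 0 r \<inter> span (insert x B)"
    then obtain t where t: "v - t *\<^sub>R x \<in> span B"
      by (auto simp: span_insert)
    have "\<bar>t\<bar> * d \<le> norm v" using coeff[OF t, of t] by simp
    also have "\<dots> \<le> \<bar>r\<bar>" using v by auto
    finally have tT: "\<bar>t\<bar> \<le> T" using d by (simp add: T_def field_simps)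
    have "norm (v - t *\<^sub>R x) \<le> norm v + \<bar>t\<bar> * norm x"
      by (metis norm_scaleR norm_triangle_ineq4)
    also have "\<dots> \<le> \<bar>r\<bar> + T * norm x" using v tT by (intro add_mono mult_right_mono) auto
    finally have "(t, v - t *\<^sub>R x) \<in> {-T..T} \<times> (cball 0 (\<bar>r\<bar> + T * norm x) \<inter> span B)"
      using t tT by auto
    from imageI[OF this, of "\<lambda>(t, s). t *\<^sub>R x + s"] show "v \<in> cball 0 r \<inter> ?K" using v by simp
  next
    fix v assume v: "v \<in> cball 0 r \<inter> ?K"
    then obtain t s where "v = t *\<^sub>R x + s" "s \<in> span B" by auto
    then have "v - t *\<^sub>R x \<in> span B" by simp
    then show "v \<in> cball 0 r \<inter> span (insert x B)" using v by (auto simp: span_insert)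
  qed
  ultimately show ?thesis by (simp add: closed_Int_compact)
qed

lemma compact_cball_span_finite:
  fixes B :: "'b::real_normed_vector set"
  assumes "finite B"
  shows "compact (cball 0 r \<inter> span B)"
  using assms
proof (induction B arbitrary: r)
  case empty
  have "cball (0::'b) r \<inter> {0} = (if r \<ge> 0 then {0} else {})" by auto
  then show ?case by simp
next
  case (insert x B)
  then show ?case
    by (cases "x \<in> span B") (auto simp: span_redundant intro: compact_cball_span_insert)
qed

lemma closed_span_finite:
  fixes B :: "'b::real_normed_vector set"
  assumes "finite B"
  shows "closed (span B)"
  using compact_cball_span_finite[OF assms] by (rule closed_if_compact_Int_cball)

lemma no_bounded_separated_sequence:
  fixes z :: "nat \<Rightarrow> 'b::real_normed_vector"
  assumes "finite B" "span B = (UNIV :: 'b set)" and bd: "\<And>n. norm (z n) \<le> r"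
    and \<delta>: "\<delta> > 0" and sep: "\<And>i j. i \<noteq> j \<Longrightarrow> \<delta> \<le> norm (z i - z j)"
  shows False
proof -
  have "compact (cball (0::'b) r)" using compact_cball_span_finite[OF assms(1), of r] assms(2) by simp
  moreover have "\<forall>n. z n \<in> cball 0 r" using bd by simp
  ultimately obtain l s where s: "strict_mono s" and lim: "(z \<circ> s) \<longlonglongrightarrow> l"
    by (metis compact_def)
  have "Cauchy (z \<circ> s)" using lim by (rule LIMSEQ_imp_Cauchy)
  then obtain M where "\<And>m n. m \<ge> M \<Longrightarrow> n \<ge> M \<Longrightarrow> norm ((z \<circ> s) m - (z \<circ> s) n) < \<delta>"
    using \<delta> unfolding Cauchy_iff by blast
  from this[of M "Suc M"] have "norm (z (s M) - z (s (Suc M))) < \<delta>" by simp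
  moreover have "s M \<noteq> s (Suc M)" using s by (simp add: strict_mono_eq)
  ultimately show False using sep by fastforce
qed

section \<open>Finite-dimensional targets\<close>

text \<open>
  In a tree of height \<open>K\<close> the disjoint branches \<open>{i + 1..i + K}\<close> end in infinitely many nodes at
  distance \<open>K\<close> from the root and \<open>2 * K\<close> from each other. For large \<open>K\<close> a coarse embedding maps
  them to a bounded sequence whose terms are at distance at least \<open>1\<close> from each other.
\<close>

lemma not_equi_coarsely_embeds_finite_span:
  assumes B: "finite B" "span B = (UNIV :: 'b::real_normed_vector set)"
  shows "\<not> equi_coarsely_embeds {1..} branching_tree (euclidean_metric :: 'b metric)"
proof
  assume "equi_coarsely_embeds {1..} branching_tree (euclidean_metric :: 'b metric)"
  then obtain \<rho> \<omega> and f :: "nat \<Rightarrow> nat set \<Rightarrow> 'b"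
    where \<omega>: "\<omega> \<in> {0..} \<rightarrow> {0::real..}" and lim: "filterlim \<rho> at_top (at_top :: real filter)"
      and f: "\<And>i t. i \<ge> 1 \<Longrightarrow> t \<ge> 0 \<Longrightarrow>
          ennreal (\<rho> t) \<le> compression_modulus (branching_tree i) euclidean_metric (f i) t \<and>
          expansion_modulus (branching_tree i) euclidean_metric (f i) t \<le> ennreal (\<omega> t)"
    unfolding equi_coarsely_embeds_def by (metis atLeast_iff)
  obtain t0 where t0: "\<And>t. t \<ge> t0 \<Longrightarrow> \<rho> t \<ge> 1"
    using lim by (auto simp: filterlim_at_top eventually_at_top_linorder)
  define K where "K = nat \<lceil>t0\<rceil> + 1"
  have "t0 \<le> real K" using real_nat_ceiling_ge[of t0] by (simp add: K_def)
  then have K: "K \<ge> 1" "2 * real K \<ge> t0" by (simp_all add: K_def)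
  define a where "a i = {Suc i..i + K}" for i
  have sl: "sorted_list_of_set (a i) = [Suc i..<Suc (i + K)]" for i
    unfolding a_def atLeastLessThanSuc_atLeastAtMost[symmetric] by (rule sorted_list_of_set_range)
  have sl': "\<exists>xs. sorted_list_of_set (a i) = Suc i # xs" for i
    unfolding sl using K upt_conv_Cons[of "Suc i" "Suc (i + K)"] by simp
  have meet: "a i \<and>\<^sub>T a j = {}" if "i \<noteq> j" for i j
    using that sl'[of i] sl'[of j] by (auto simp: tree_meet_def)
  have dij: "tree_dist (a i) (a j) = 2 * real K" if "i \<noteq> j" for i j
    using meet[OF that] by (simp add: tree_dist_def a_def)
  have d0: "tree_dist (a i) {} = real K" for i
    by (simp add: tree_dist_def tree_meet_def a_def)
  have a: "a i \<in> nat_subsets_le K" "{} \<in> nat_subsets_le K" for i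
    by (auto simp: nat_subsets_le_def a_def)
  have sep: "1 \<le> norm (f K (a i) - f K (a j))" if "i \<noteq> j" for i j
  proof -
    have "ennreal 1 \<le> ennreal (\<rho> (2 * real K))" using t0 K by (simp add: ennreal_leI del: ennreal_1)
    also have "\<dots> \<le> compression_modulus (branching_tree K) euclidean_metric (f K) (2 * real K)"
      using f[of K] K by simp
    also have "\<dots> \<le> ennreal (dist (f K (a i)) (f K (a j)))"
      unfolding compression_modulus_def using a dij[OF that]
      by (intro Inf_lower) force
    finally show ?thesis by (simp add: dist_norm del: ennreal_1)
  qed
  have bd: "norm (f K (a i) - f K {}) \<le> \<omega> (real K)" for i
  proof -
    have "ennreal (dist (f K (a i)) (f K {})) \<le>
        expansion_modulus (branching_tree K) euclidean_metric (f K) (real K)"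
      unfolding expansion_modulus_def using a d0[of i]
      by (intro Sup_upper) force
    also have "\<dots> \<le> ennreal (\<omega> (real K))" using f[of K] K by simp
    finally show ?thesis using \<omega> by (auto simp: dist_norm ennreal_le_iff Pi_iff)
  qed
  show False
    using no_bounded_separated_sequence[OF B, of "\<lambda>i. f K (a i) - f K {}" "\<omega> (real K)" 1] bd sep
    by simp
qed

section \<open>Separated sequences in infinite dimensions\<close>

text \<open>
  This is Riesz's lemma with constant \<open>1/2\<close>: normalise \<open>x - s0\<close>, where \<open>s0\<close> realises the distance
  from \<open>x\<close> to the span up to a factor \<open>2\<close>.
\<close>

lemma exists_unit_vector_far_from_span:
  fixes B :: "'b::real_normed_vector set"
  assumes "finite B" "span B \<noteq> UNIV"
  shows "\<exists>v. norm v = 1 \<and> (\<forall>s\<in>span B. 1/2 \<le> norm (v - s))"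
proof -
  obtain x where x: "x \<notin> span B" using assms by auto
  define d where "d = infdist x (span B)"
  have d: "d > 0"
    using infdist_pos_not_in_closed[OF closed_span_finite[OF assms(1)] _ x] span_zero d_def by blast
  have ne: "span B \<noteq> {}" using span_zero by blast
  have "infdist x (span B) < 2 * d" using d by (simp add: d_def)
  then obtain s0 where s0: "s0 \<in> span B" "dist x s0 < 2 * d"
    using ne by (auto simp: infdist_notempty cINF_less_iff)
  define N where "N = norm (x - s0)"
  have N: "N < 2 * d" "N > 0" using s0 x unfolding N_def by (auto simp: dist_norm)
  have "1/2 \<le> norm ((1/N) *\<^sub>R (x - s0) - s)" if s: "s \<in> span B" for s
  proof -
    have "s0 + N *\<^sub>R s \<in> span B" using s s0 by (simp add: span_add span_scale)
    then have "d \<le> norm (x - (s0 + N *\<^sub>R s))" unfolding d_def by (metis dist_norm infdist_le)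
    also have "x - (s0 + N *\<^sub>R s) = N *\<^sub>R ((1/N) *\<^sub>R (x - s0) - s)"
      using N by (simp add: algebra_simps)
    also have "norm \<dots> = N * norm ((1/N) *\<^sub>R (x - s0) - s)" using N by simp
    finally have "N * (1/2) \<le> N * norm ((1/N) *\<^sub>R (x - s0) - s)" using N(1) by linarith
    then show ?thesis using N(2) by (rule mult_left_le_imp_le)
  qed
  moreover have "norm ((1/N) *\<^sub>R (x - s0)) = 1" using N by (simp add: N_def)
  ultimately show ?thesis by blast
qed

lemma exists_separated_unit_sequence:
  assumes "\<And>B :: 'b::real_normed_vector set. finite B \<Longrightarrow> span B \<noteq> UNIV"
  shows "\<exists>y :: nat \<Rightarrow> 'b. (\<forall>n. norm (y n) = 1) \<and> (\<forall>i j. i \<noteq> j \<longrightarrow> 1/2 \<le> norm (y i - y j))"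
proof -
  let ?P = "\<lambda>(f :: nat \<Rightarrow> 'b) n r. norm r = 1 \<and> (\<forall>i<n. 1/2 \<le> norm (r - f i))"
  have "\<exists>f. \<forall>n. ?P f n (f n)"
  proof (rule dependent_wellorder_choice)
    fix n and f :: "nat \<Rightarrow> 'b"
    have "finite (f ` {..<n})" by simp
    then obtain v where "norm v = 1" "\<And>s. s \<in> span (f ` {..<n}) \<Longrightarrow> 1/2 \<le> norm (v - s)"
      using exists_unit_vector_far_from_span[OF _ assms] by metis
    then show "\<exists>r. ?P f n r" by (meson imageI lessThan_iff span_base)
  qed auto
  then obtain y :: "nat \<Rightarrow> 'b"
    where y: "\<And>n. norm (y n) = 1" "\<And>n i. i < n \<Longrightarrow> 1/2 \<le> norm (y n - y i)"
    by auto
  have "1/2 \<le> norm (y i - y j)" if "i \<noteq> j" for i j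
    using y(2)[of i j] y(2)[of j i] that by (metis linorder_neqE_nat norm_minus_commute)
  then show ?thesis using y by blast
qed

section \<open>Ramsey's theorem for sums with prescribed coefficients\<close>

text \<open>
  The coefficients are assigned to the elements of \<open>X\<close> in increasing order. Ramsey's theorem
  colours sets, so a condition on the vectors \<open>y n\<close> at increasing positions is
  expressed through the set of these positions.
\<close>

definition pattern_sum :: "(nat \<Rightarrow> 'b::real_vector) \<Rightarrow> real list \<Rightarrow> nat set \<Rightarrow> 'b" where
  "pattern_sum y c X = (\<Sum>i<length c. c ! i *\<^sub>R y (sorted_list_of_set X ! i))"

lemma sorted_list_of_set_strict_mono_image:
  fixes g :: "nat \<Rightarrow> nat"
  assumes "strict_mono_on {..<N} g"
  shows "sorted_list_of_set (g ` {..<N}) = map g [0..<N]"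
proof -
  have "sorted_wrt (<) (map g [0..<N])"
    using assms by (simp add: sorted_wrt_iff_nth_less strict_mono_on_def)
  moreover have "set (map g [0..<N]) = g ` {..<N}" by (auto simp: atLeast0LessThan)
  ultimately show ?thesis
    by (intro strict_sorted_equal) auto
qed

text \<open>
  This lemma and the next one are the two ways in which pattern sums arise: from an increasing
  choice of positions, and from coefficients indexed by the positions themselves.
\<close>

lemma pattern_sum_image:
  assumes "strict_mono_on {..<length c} g"
  shows "pattern_sum y c (g ` {..<length c}) = (\<Sum>i<length c. c ! i *\<^sub>R y (g i))"
  unfolding pattern_sum_def sorted_list_of_set_strict_mono_image[OF assms] by simp

lemma pattern_sum_map:
  assumes "finite X"
  shows "pattern_sum y (map a (sorted_list_of_set X)) X = (\<Sum>x\<in>X. a x *\<^sub>R y x)"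
proof -
  let ?xs = "sorted_list_of_set X"
  have "pattern_sum y (map a ?xs) X = (\<Sum>i<length ?xs. (\<lambda>x. a x *\<^sub>R y x) (?xs ! i))"
    unfolding pattern_sum_def by simp
  also have "\<dots> = (\<Sum>x\<leftarrow>?xs. a x *\<^sub>R y x)"
    by (simp add: sum_list_sum_nth atLeast0LessThan)
  also have "\<dots> = (\<Sum>x\<in>X. a x *\<^sub>R y x)"
    using assms by (simp add: sum_list_distinct_conv_sum_set)
  finally show ?thesis .
qed

text \<open>
  For a single property, Ramsey's theorem gives an infinite set on which it holds always or never,
  and the assumption excludes never. Finitely many properties are treated one after another, since
  what has been achieved persists in subsets.
\<close>

lemma ramsey_simultaneous:
  fixes Q :: "'i \<Rightarrow> 'a set \<Rightarrow> bool" and r :: "'i \<Rightarrow> nat"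
  assumes "finite I" "infinite M"
    and ex: "\<And>i M'. i \<in> I \<Longrightarrow> infinite M' \<Longrightarrow> \<exists>X\<subseteq>M'. finite X \<and> card X = r i \<and> Q i X"
  shows "\<exists>M'\<subseteq>M. infinite M' \<and> (\<forall>i\<in>I. \<forall>X\<subseteq>M'. finite X \<and> card X = r i \<longrightarrow> Q i X)"
  using assms(1) ex
proof (induction I)
  case empty
  then show ?case using assms(2) by auto
next
  case (insert i I)
  then obtain M1 where M1: "M1 \<subseteq> M" "infinite M1"
    "\<forall>j\<in>I. \<forall>X\<subseteq>M1. finite X \<and> card X = r j \<longrightarrow> Q j X"
    by (metis insertCI)
  have "\<exists>Y t. Y \<subseteq> M1 \<and> infinite Y \<and> t < (2::nat) \<and>
      (\<forall>X. X \<subseteq> Y \<and> finite X \<and> card X = r i \<longrightarrow> (if Q i X then 0 else 1) = t)"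
    by (rule Ramsey[OF M1(2)]) auto
  then obtain Y t where Y: "Y \<subseteq> M1" "infinite Y"
    and t: "\<forall>X. X \<subseteq> Y \<and> finite X \<and> card X = r i \<longrightarrow> (if Q i X then 0 else 1) = (t::nat)"
    by (elim exE conjE)
  obtain X0 where X0: "X0 \<subseteq> Y" "finite X0" "card X0 = r i" "Q i X0"
    using insert.prems[of i Y] Y by auto
  have "t = 0" using t[rule_format, of X0] X0 by simp
  then have "Q i X" if "X \<subseteq> Y" "finite X" "card X = r i" for X
    using t[rule_format, of X] that by (simp split: if_splits)
  then have "\<forall>j\<in>insert i I. \<forall>X\<subseteq>Y. finite X \<and> card X = r j \<longrightarrow> Q j X"
    using M1(3) Y(1) by (auto dest: subset_trans)
  then show ?case using Y M1(1) by (meson subset_trans)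
qed

section \<open>Trees of lists\<close>

text \<open>
  A node of the tree is replaced by the increasing list of its elements; the initial segments of a
  node become the prefixes of the list.
\<close>

definition nonempty_prefixes :: "'a list \<Rightarrow> 'a list set" where
  "nonempty_prefixes xs = {s. s \<noteq> [] \<and> prefix s xs}"

definition list_tree_dist :: "'a list \<Rightarrow> 'a list \<Rightarrow> nat" where
  "list_tree_dist xs ys = length xs + length ys - 2 * length (longest_common_prefix xs ys)"

lemma nonempty_prefixes_eq_image:
  "nonempty_prefixes xs = (\<lambda>i. take (Suc i) xs) ` {..<length xs}"
proof (intro equalityI subsetI)
  fix s assume "s \<in> nonempty_prefixes xs"
  then have s: "s \<noteq> []" "prefix s xs" by (auto simp: nonempty_prefixes_def)
  then obtain i where i: "length s = Suc i" by (cases s) auto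
  then have "s = take (Suc i) xs" "i < length xs"
    using s(2) prefix_length_le[OF s(2)] by (auto simp: prefix_def)
  then show "s \<in> (\<lambda>i. take (Suc i) xs) ` {..<length xs}" by blast
qed (auto simp: nonempty_prefixes_def take_is_prefix)

lemma inj_on_take_Suc: "inj_on (\<lambda>i. take (Suc i) xs) {..<length xs}"
proof (rule inj_onI)
  fix i j assume "i \<in> {..<length xs}" "j \<in> {..<length xs}" "take (Suc i) xs = take (Suc j) xs"
  then show "i = j" by (metis Suc_inject Suc_le_eq length_take lessThan_iff min.absorb2)
qed

lemma finite_nonempty_prefixes [simp]: "finite (nonempty_prefixes xs)"
  by (simp add: nonempty_prefixes_eq_image)

lemma card_nonempty_prefixes [simp]: "card (nonempty_prefixes xs) = length xs"
  by (simp add: nonempty_prefixes_eq_image card_image inj_on_take_Suc)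

lemma nonempty_prefixes_Int:
  "nonempty_prefixes xs \<inter> nonempty_prefixes ys = nonempty_prefixes (longest_common_prefix xs ys)"
  unfolding nonempty_prefixes_def
  using longest_common_prefix_max_prefix longest_common_prefix_prefix1 longest_common_prefix_prefix2
    prefix_order.trans by blast

text \<open>
  The geodesic between two nodes has one edge for each prefix that belongs to only one of them.
\<close>

lemma list_tree_dist_eq_card:
  "list_tree_dist xs ys = card ((nonempty_prefixes xs - nonempty_prefixes ys)
      \<union> (nonempty_prefixes ys - nonempty_prefixes xs))"
proof -
  let ?P = nonempty_prefixes and ?j = "length (longest_common_prefix xs ys)"
  have "card (?P xs \<inter> ?P ys) = ?j" unfolding nonempty_prefixes_Int by simp
  then have "card (?P xs - ?P ys) = length xs - ?j" "card (?P ys - ?P xs) = length ys - ?j"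
    using Int_commute[of "?P xs" "?P ys"] by (simp_all add: card_Diff_subset_Int)
  moreover have "card ((?P xs - ?P ys) \<union> (?P ys - ?P xs)) = card (?P xs - ?P ys) + card (?P ys - ?P xs)"
    by (rule card_Un_disjoint) auto
  ultimately show ?thesis
    using length_longest_common_prefix_le1[of xs ys] length_longest_common_prefix_le2[of xs ys]
    by (simp add: list_tree_dist_def)
qed

lemma tree_dist_eq_list_tree_dist:
  "tree_dist m n = real (list_tree_dist (sorted_list_of_set m) (sorted_list_of_set n))"
  using length_longest_common_prefix_le1[of "sorted_list_of_set m" "sorted_list_of_set n"]
    length_longest_common_prefix_le2[of "sorted_list_of_set m" "sorted_list_of_set n"]
  by (simp add: tree_dist_def card_tree_meet list_tree_dist_def)

lemma prod_encode_mono: "i < j \<Longrightarrow> prod_encode (x, i) < prod_encode (x, j)"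
proof -
  have "strict_mono triangle" by (rule strict_mono_Suc_iff[THEN iffD2]) simp
  moreover assume "i < j"
  ultimately have "triangle (x + i) < triangle (x + j)" by (simp add: strict_monoD)
  then show ?thesis by (simp add: prod_encode_def)
qed

text \<open>
  The code of a list serves as the position of its vector. Since codes increase along
  prefixes, the vectors of a branch occur in the order of the branch.
\<close>

lemma list_encode_strict_prefix:
  "strict_prefix s t \<Longrightarrow> list_encode s < list_encode t"
proof (induction s arbitrary: t)
  case Nil
  then show ?case by (cases t) auto
next
  case (Cons x s)
  then obtain t' where "t = x # t'" "strict_prefix s t'" by (cases t) auto
  then show ?case using Cons.IH prod_encode_mono by auto
qed

lemma strict_mono_on_list_encode_take:
  "strict_mono_on {..<length xs} (\<lambda>i. list_encode (take (Suc i) xs))"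
proof (rule strict_mono_onI)
  fix i j assume "i \<in> {..<length xs}" "j \<in> {..<length xs}" "i < j"
  then have "length (take (Suc i) xs) < length (take (Suc j) xs)" by simp
  moreover have "prefix (take (Suc i) xs) (take (Suc j) xs)"
    using \<open>i < j\<close> take_is_prefix[of "Suc i" "take (Suc j) xs"] by (simp add: min_def)
  ultimately have "strict_prefix (take (Suc i) xs) (take (Suc j) xs)"
    by (metis less_irrefl strict_prefix_def)
  then show "list_encode (take (Suc i) xs) < list_encode (take (Suc j) xs)"
    by (rule list_encode_strict_prefix)
qed

text \<open>
  The compression is recorded by thresholds: distance at least \<open>T R\<close> in the tree forces distance at
  least \<open>R\<close> in the image. \<open>C\<close> and \<open>T\<close> do not depend on the height \<open>k\<close>.
\<close>

definition coarse_list_tree_embeddings :: "'b::real_normed_vector itself \<Rightarrow> bool" where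
  "coarse_list_tree_embeddings TYPE('b) \<longleftrightarrow>
    (\<exists>C\<ge>0. \<exists>T :: nat \<Rightarrow> nat. \<forall>k. \<exists>F :: nat list \<Rightarrow> 'b. \<forall>xs ys. length xs \<le> k \<longrightarrow> length ys \<le> k \<longrightarrow>
      norm (F xs - F ys) \<le> C * real (list_tree_dist xs ys) \<and>
      (\<forall>R. T R \<le> list_tree_dist xs ys \<longrightarrow> real R \<le> norm (F xs - F ys)))"

lemma equi_coarsely_embedsI:
  assumes "coarse_list_tree_embeddings TYPE('b::real_normed_vector)"
  shows "equi_coarsely_embeds {1..} branching_tree (euclidean_metric :: 'b metric)"
proof -
  from assms obtain C T where C: "C \<ge> 0" and ex: "\<forall>k. \<exists>F :: nat list \<Rightarrow> 'b. \<forall>xs ys. 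
      length xs \<le> k \<longrightarrow> length ys \<le> k \<longrightarrow>
      norm (F xs - F ys) \<le> C * real (list_tree_dist xs ys) \<and>
      (\<forall>R. T R \<le> list_tree_dist xs ys \<longrightarrow> real R \<le> norm (F xs - F ys))"
    unfolding coarse_list_tree_embeddings_def by blast
  from choice[OF ex] obtain F :: "nat \<Rightarrow> nat list \<Rightarrow> 'b" where F: "\<forall>k xs ys. length xs \<le> k \<longrightarrow> length ys \<le> k \<longrightarrow>
      norm (F k xs - F k ys) \<le> C * real (list_tree_dist xs ys) \<and>
      (\<forall>R. T R \<le> list_tree_dist xs ys \<longrightarrow> real R \<le> norm (F k xs - F k ys))"
    by blast
  \<comment> \<open>The best lower bound that the thresholds give at distance \<open>t\<close>. The restriction \<open>R \<le> t\<close> keeps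
    the maximum finite.\<close>
  define A where "A t = insert 0 {R. real R \<le> t \<and> real (T R) \<le> t}" for t
  define \<rho> where "\<rho> t = real (Max (A t))" for t
  define f where "f k m = F k (sorted_list_of_set m)" for k m
  have finA: "finite (A t)" for t
  proof (rule finite_subset)
    show "A t \<subseteq> {..nat \<lceil>t\<rceil>}" unfolding A_def by (auto simp: le_nat_iff) linarith
  qed simp
  have neA: "A t \<noteq> {}" for t by (simp add: A_def)
  have mono: "mono_on {0..} \<rho>"
    unfolding mono_on_def \<rho>_def
  proof (intro allI impI)
    fix r s :: real assume "r \<in> {0..} \<and> s \<in> {0..} \<and> r \<le> s"
    then have "A r \<subseteq> A s" by (auto simp: A_def)
    then show "real (Max (A r)) \<le> real (Max (A s))" using Max_mono[OF _ neA finA] by simp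
  qed
  have lim: "filterlim \<rho> at_top at_top"
    unfolding filterlim_at_top eventually_at_top_linorder
  proof
    fix Z :: real
    let ?R = "nat \<lceil>Z\<rceil>"
    have "Z \<le> \<rho> t" if "t \<ge> max (real ?R) (real (T ?R))" for t
    proof -
      have "?R \<in> A t" using that by (simp add: A_def)
      then have "?R \<le> Max (A t)" using finA[of t] by (intro Max_ge)
      moreover have "Z \<le> real ?R" by (rule real_nat_ceiling_ge)
      ultimately show ?thesis unfolding \<rho>_def by linarith
    qed
    then show "\<exists>N. \<forall>t\<ge>N. Z \<le> \<rho> t" by blast
  qed
  have lower: "\<rho> t \<le> dist (f k m) (f k n)"
    if "m \<in> nat_subsets_le k" "n \<in> nat_subsets_le k" "t \<le> tree_dist m n" for k m n t
  proof -
    have "Max (A t) \<in> A t" using finA neA by (rule Max_in)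
    then consider "Max (A t) = 0" | "real (T (Max (A t))) \<le> t" by (auto simp: A_def)
    then show ?thesis
    proof cases
      case 2
      then have "T (Max (A t)) \<le> list_tree_dist (sorted_list_of_set m) (sorted_list_of_set n)"
        using that(3) by (simp add: tree_dist_eq_list_tree_dist)
      then show ?thesis
        using F that(1,2) by (simp add: f_def \<rho>_def dist_norm nat_subsets_le_def)
    qed (simp add: \<rho>_def)
  qed
  have upper: "dist (f k m) (f k n) \<le> C * t"
    if "m \<in> nat_subsets_le k" "n \<in> nat_subsets_le k" "tree_dist m n \<le> t" for k m n t
  proof -
    have "dist (f k m) (f k n) \<le> C * tree_dist m n"
      using F that(1,2) by (simp add: f_def dist_norm nat_subsets_le_def tree_dist_eq_list_tree_dist)
    also have "\<dots> \<le> C * t" using that(3) C by (rule mult_left_mono)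
    finally show ?thesis .
  qed
  show ?thesis
    unfolding equi_coarsely_embeds_def
  proof (intro exI conjI ballI allI impI)
    show "\<rho> \<in> {0..} \<rightarrow> {0..}" by (simp add: \<rho>_def)
    show "(\<lambda>t. C * t) \<in> {0..} \<rightarrow> {0..}" using C by simp
    show "mono_on {0..} (\<lambda>t. C * t)" using C by (simp add: mono_on_def mult_left_mono)
    fix k t
    show "ennreal (\<rho> t) \<le> compression_modulus (branching_tree k) euclidean_metric (f k) t"
      unfolding compression_modulus_def using lower by (auto intro!: Inf_greatest ennreal_leI)
    show "expansion_modulus (branching_tree k) euclidean_metric (f k) t \<le> ennreal (C * t)"
      unfolding expansion_modulus_def using upper by (auto intro!: Sup_least ennreal_leI)
  qed (use mono lim in auto)
qed

section \<open>Unbounded sums of signs\<close>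

lemma strict_mono_on_lessThanI:
  fixes g :: "nat \<Rightarrow> nat"
  assumes "\<And>i. Suc i < N \<Longrightarrow> g i < g (Suc i)"
  shows "strict_mono_on {..<N} g"
proof (rule strict_mono_onI)
  fix i j assume "i \<in> {..<N}" and j: "j \<in> {..<N}" and "i < j"
  have "j < N \<Longrightarrow> g i < g j" using \<open>i < j\<close>
  proof (induction j)
    case (Suc j)
    then show ?case using assms[of j] by (cases "i = j") auto
  qed simp
  then show "g i < g j" using j by simp
qed

text \<open>
  Send a list to the sum of the vectors attached to its nonempty prefixes. The difference of two
  images is a sum of signs with as many terms as the tree distance. The triangle inequality
  bounds it from above, and the assumption bounds it from below once the positions come from
  a suitable infinite set. The order in which the two signs alternate depends on the two lists, so all sign
  patterns of a given length have to give large sums; for a fixed height these are finitely many.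
\<close>

lemma embeddings_if_sign_sums_unbounded:
  fixes y :: "nat \<Rightarrow> 'b::real_normed_vector" and T :: "nat \<Rightarrow> nat"
  assumes y: "\<And>n. norm (y n) = 1"
    and T: "\<And>R c M. T R \<le> length c \<Longrightarrow> set c \<subseteq> {-1, 1} \<Longrightarrow> infinite M \<Longrightarrow>
      \<exists>X\<subseteq>M. finite X \<and> card X = length c \<and> real R \<le> norm (pattern_sum y c X)"
  shows "coarse_list_tree_embeddings TYPE('b)"
  unfolding coarse_list_tree_embeddings_def
proof (intro exI[of _ 1] exI[of _ "\<lambda>R. max (T R) R"] conjI allI)
  fix k :: nat
  \<comment> \<open>With the threshold \<open>max (T R) R\<close> instead of \<open>T R\<close>, only values \<open>R \<le> 2 * k\<close> matter for a tree of
    height \<open>k\<close>, so that finitely many properties enter Ramsey's theorem.\<close>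
  define I where "I = {(c :: real list, R). set c \<subseteq> {-1, 1} \<and> length c \<le> 2 * k \<and> max (T R) R \<le> length c}"
  have "I \<subseteq> {c. set c \<subseteq> {-1, 1} \<and> length c \<le> 2 * k} \<times> {..2 * k}"
    unfolding I_def by auto
  moreover have "finite ({c :: real list. set c \<subseteq> {-1, 1} \<and> length c \<le> 2 * k} \<times> {..2 * k})"
    using finite_lists_length_le[of "{-1, 1 :: real}" "2 * k"] by simp
  ultimately have "finite I" by (rule finite_subset)
  moreover have "\<exists>X\<subseteq>M. finite X \<and> card X = length (fst i) \<and> real (snd i) \<le> norm (pattern_sum y (fst i) X)"
    if "i \<in> I" "infinite M" for i M
    using that T by (auto simp: I_def)
  ultimately obtain M where M: "infinite M"
    and large: "\<forall>i\<in>I. \<forall>X\<subseteq>M. finite X \<and> card X = length (fst i) \<longrightarrow>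
        real (snd i) \<le> norm (pattern_sum y (fst i) X)"
    using ramsey_simultaneous[of I UNIV "\<lambda>i. length (fst i)"
        "\<lambda>i X. real (snd i) \<le> norm (pattern_sum y (fst i) X)"] by auto
  define G where "G s = enumerate M (list_encode s)" for s
  have inj: "inj_on G A" for A
    by (simp add: G_def inj_on_def list_encode_eq strict_mono_eq[OF strict_mono_enumerate[OF M]])
  have GM: "G s \<in> M" for s unfolding G_def using M by (rule enumerate_in_set)
  define F where "F xs = (\<Sum>s\<in>nonempty_prefixes xs. y (G s))" for xs
  have "norm (F xs - F ys) \<le> 1 * real (list_tree_dist xs ys) \<and>
      (\<forall>R. max (T R) R \<le> list_tree_dist xs ys \<longrightarrow> real R \<le> norm (F xs - F ys))"
    if len: "length xs \<le> k" "length ys \<le> k" for xs ys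
  proof -
    define A where "A = nonempty_prefixes xs - nonempty_prefixes ys"
    define B where "B = nonempty_prefixes ys - nonempty_prefixes xs"
    define X where "X = G ` (A \<union> B)"
    define a :: "nat \<Rightarrow> real" where "a x = (if x \<in> G ` A then 1 else -1)" for x
    have fin: "finite A" "finite B" "finite X" by (simp_all add: A_def B_def X_def)
    have AB: "A \<inter> B = {}" by (auto simp: A_def B_def)
    have GB: "G s \<notin> G ` A" if "s \<in> B" for s
      using that AB inj[of UNIV] by (auto simp: inj_on_def)
    have cardX: "card X = list_tree_dist xs ys"
      by (simp add: X_def card_image inj A_def B_def list_tree_dist_eq_card)
    have "F xs - F ys = (\<Sum>s\<in>A. y (G s)) - (\<Sum>s\<in>B. y (G s))"
      using sum.Int_Diff[of "nonempty_prefixes xs" "\<lambda>s. y (G s)" "nonempty_prefixes ys"]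
        sum.Int_Diff[of "nonempty_prefixes ys" "\<lambda>s. y (G s)" "nonempty_prefixes xs"]
      by (simp add: F_def A_def B_def Int_commute)
    also have "\<dots> = (\<Sum>s\<in>A. a (G s) *\<^sub>R y (G s)) + (\<Sum>s\<in>B. a (G s) *\<^sub>R y (G s))"
      using GB by (simp add: a_def sum_negf)
    also have "\<dots> = (\<Sum>s\<in>A \<union> B. a (G s) *\<^sub>R y (G s))"
      using fin AB by (simp add: sum.union_disjoint)
    also have "\<dots> = (\<Sum>x\<in>X. a x *\<^sub>R y x)"
      unfolding X_def by (simp add: sum.reindex[OF inj])
    finally have eq: "F xs - F ys = (\<Sum>x\<in>X. a x *\<^sub>R y x)" .
    have "norm (F xs - F ys) \<le> (\<Sum>x\<in>X. norm (a x *\<^sub>R y x))" unfolding eq by (rule norm_sum)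
    also have "\<dots> = real (list_tree_dist xs ys)" 
    proof -
      have "norm (a x *\<^sub>R y x) = 1" for x by (simp add: a_def y)
      then show ?thesis by (simp add: cardX)
    qed
    finally have upper: "norm (F xs - F ys) \<le> 1 * real (list_tree_dist xs ys)" by simp
    let ?c = "map a (sorted_list_of_set X)"
    have "real R \<le> norm (F xs - F ys)" if R: "max (T R) R \<le> list_tree_dist xs ys" for R
    proof -
      have "list_tree_dist xs ys \<le> 2 * k" using len by (simp add: list_tree_dist_def)
      then have "(?c, R) \<in> I" using R by (auto simp: I_def cardX a_def)
      moreover have "X \<subseteq> M" using GM by (auto simp: X_def)
      ultimately have "real R \<le> norm (pattern_sum y ?c X)" using large[rule_format, of "(?c, R)" X] fin by simp
      then show ?thesis using eq pattern_sum_map[OF fin(3), of y a] by simp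
    qed
    with upper show ?thesis by blast
  qed
  then show "\<exists>F :: nat list \<Rightarrow> 'b. \<forall>xs ys. length xs \<le> k \<longrightarrow> length ys \<le> k \<longrightarrow>
      norm (F xs - F ys) \<le> 1 * real (list_tree_dist xs ys) \<and>
      (\<forall>R. max (T R) R \<le> list_tree_dist xs ys \<longrightarrow> real R \<le> norm (F xs - F ys))"
    by blast
qed simp

section \<open>Differences of separated vectors\<close>

definition difference_pattern :: "real list \<Rightarrow> real list" where
  "difference_pattern b = map (\<lambda>i. if even i then b ! (i div 2) else - b ! (i div 2)) [0..<2 * length b]"

lemma length_difference_pattern [simp]: "length (difference_pattern b) = 2 * length b"
  by (simp add: difference_pattern_def)

lemma sum_lessThan_double:
  "(\<Sum>i<2 * n. f i) = (\<Sum>i<n. f (2 * i) + f (Suc (2 * i)) :: 'a::comm_monoid_add)"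
  by (induction n) (simp_all add: add.assoc)

lemma pattern_sum_difference_pattern:
  fixes u v :: "nat \<Rightarrow> nat"
  assumes uv: "\<And>i. i < length b \<Longrightarrow> u i < v i" and vu: "\<And>i. Suc i < length b \<Longrightarrow> v i < u (Suc i)"
    and M: "\<And>i. i < length b \<Longrightarrow> u i \<in> M \<and> v i \<in> M"
  shows "\<exists>X\<subseteq>M. finite X \<and> card X = length (difference_pattern b) \<and>
    pattern_sum y (difference_pattern b) X = (\<Sum>i<length b. b ! i *\<^sub>R (y (u i) - y (v i)))"
proof -
  define g where "g i = (if even i then u (i div 2) else v (i div 2))" for i
  let ?N = "length (difference_pattern b)"
  have mono: "strict_mono_on {..<?N} g"
  proof (rule strict_mono_on_lessThanI)
    fix i assume i: "Suc i < ?N"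
    show "g i < g (Suc i)"
    proof (cases "even i")
      case True
      then show ?thesis using i uv[of "i div 2"] by (auto simp: g_def elim!: evenE)
    next
      case False
      then show ?thesis using i vu[of "i div 2"] by (auto simp: g_def elim!: oddE)
    qed
  qed
  have "pattern_sum y (difference_pattern b) (g ` {..<?N})
      = (\<Sum>i<2 * length b. difference_pattern b ! i *\<^sub>R y (g i))"
    using pattern_sum_image[OF mono] by simp
  also have "\<dots> = (\<Sum>i<length b. b ! i *\<^sub>R (y (u i) - y (v i)))"
    unfolding sum_lessThan_double
    by (intro sum.cong) (auto simp: difference_pattern_def g_def algebra_simps)
  finally have "pattern_sum y (difference_pattern b) (g ` {..<?N})
      = (\<Sum>i<length b. b ! i *\<^sub>R (y (u i) - y (v i)))" .
  moreover have "g ` {..<?N} \<subseteq> M" using M by (auto simp: g_def)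
  moreover have "card (g ` {..<?N}) = ?N"
    using card_image[OF strict_mono_on_imp_inj_on[OF mono]] by simp
  ultimately show ?thesis by (meson finite_imageI finite_lessThan)
qed

text \<open>
  Suppose that all these sums of differences are small, and keep the \<open>j\<close>-th difference fixed while
  each other difference \<open>y n - y m\<close> runs through \<open>L\<close> consecutive differences. Summed over the \<open>L\<close>
  choices, the other differences telescope to vectors of norm at most \<open>2\<close>, while the \<open>j\<close>-th term is
  repeated \<open>L\<close> times and has norm at least \<open>L * \<bar>b ! j\<bar> / 2\<close>. For large \<open>L\<close> this contradicts the
  smallness.
\<close>

lemma exists_large_difference_sum:
  fixes y :: "nat \<Rightarrow> 'b::real_normed_vector"
  assumes y: "\<And>n. norm (y n) = 1" and sep: "\<forall>i j. i \<noteq> j \<longrightarrow> 1/2 \<le> norm (y i - y j)"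
    and j: "j < length b" and M: "infinite M"
  shows "\<exists>X\<subseteq>M. finite X \<and> card X = length (difference_pattern b) \<and>
    \<bar>b ! j\<bar> / 4 \<le> norm (pattern_sum y (difference_pattern b) X)"
proof (rule ccontr)
  assume "\<not> ?thesis"
  then have small: "norm (pattern_sum y (difference_pattern b) X) < \<bar>b ! j\<bar> / 4"
    if "X \<subseteq> M" "finite X" "card X = length (difference_pattern b)" for X
    using that by (meson not_le)
  obtain X0 where "X0 \<subseteq> M" "finite X0" "card X0 = length (difference_pattern b)"
    using infinite_arbitrarily_large[OF M] by metis
  from small[OF this] have pos: "\<bar>b ! j\<bar> > 0"
    using norm_ge_zero[of "pattern_sum y (difference_pattern b) X0"] by linarith
  define \<beta> where "\<beta> = (\<Sum>i<length b. \<bar>b ! i\<bar>)"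
  obtain L :: nat where "8 * \<beta> / \<bar>b ! j\<bar> < real L" using reals_Archimedean2 by blast
  then have L: "8 * \<beta> < real L * \<bar>b ! j\<bar>" using pos by (simp add: field_simps)
  define e where "e = enumerate M"
  have e: "strict_mono e" "\<And>n. e n \<in> M"
    unfolding e_def using M by (simp_all add: strict_mono_enumerate enumerate_in_set)
  \<comment> \<open>Block \<open>i\<close> consists of the \<open>L + 1\<close> positions from \<open>i * Suc L\<close> on; the difference number \<open>t\<close> uses
    the positions \<open>t\<close> and \<open>t + 1\<close> of the block, so that blocks never interleave.\<close>
  define u where "u t i = i * Suc L + (if i = j then 0 else t)" for t i
  define S where "S t = (\<Sum>i<length b. b ! i *\<^sub>R (y (e (u t i)) - y (e (Suc (u t i)))))" for t
  have S: "norm (S t) < \<bar>b ! j\<bar> / 4" if t: "t < L" for t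
  proof -
    have "e (u t i) < e (Suc (u t i))" for i using e(1) by (simp add: strict_mono_less)
    moreover have "e (Suc (u t i)) < e (u t (Suc i))" for i
      using e(1) t by (simp add: strict_mono_less u_def)
    ultimately obtain X where "X \<subseteq> M" "finite X" "card X = length (difference_pattern b)"
      "pattern_sum y (difference_pattern b) X = S t"
      using pattern_sum_difference_pattern[of b "\<lambda>i. e (u t i)" "\<lambda>i. e (Suc (u t i))" M y] e(2)
      unfolding S_def by metis
    then show ?thesis using small by metis
  qed
  define W where "W i = (\<Sum>t<L. y (e (u t i)) - y (e (Suc (u t i))))" for i
  have W: "norm (W i) \<le> 2" if "i \<noteq> j" for i
  proof -
    have "W i = (\<Sum>t<L. y (e (i * Suc L + t)) - y (e (i * Suc L + Suc t)))"
      unfolding W_def u_def using that by simp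
    also have "\<dots> = y (e (i * Suc L + 0)) - y (e (i * Suc L + L))"
      by (rule sum_lessThan_telescope')
    also have "norm \<dots> \<le> 2" using norm_triangle_ineq4 y by (metis one_add_one)
    finally show ?thesis .
  qed
  have "W j = real L *\<^sub>R (y (e (j * Suc L)) - y (e (Suc (j * Suc L))))"
    unfolding W_def u_def by (simp add: sum_constant_scaleR)
  moreover have "1/2 \<le> norm (y (e (j * Suc L)) - y (e (Suc (j * Suc L))))"
    using e(1) by (intro sep[rule_format]) (simp add: strict_mono_eq)
  ultimately have Wj: "real L * (1/2) \<le> norm (W j)"
    by (simp only: norm_scaleR abs_of_nat) (rule mult_left_mono, auto)
  have "(\<Sum>t<L. S t) = (\<Sum>i<length b. b ! i *\<^sub>R W i)"
    unfolding S_def W_def scaleR_right.sum by (rule sum.swap)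
  also have "\<dots> = b ! j *\<^sub>R W j + (\<Sum>i\<in>{..<length b} - {j}. b ! i *\<^sub>R W i)"
    using j by (simp add: sum.remove)
  finally have "b ! j *\<^sub>R W j = (\<Sum>t<L. S t) - (\<Sum>i\<in>{..<length b} - {j}. b ! i *\<^sub>R W i)"
    by simp
  then have "norm (b ! j *\<^sub>R W j) \<le> norm (\<Sum>t<L. S t) + norm (\<Sum>i\<in>{..<length b} - {j}. b ! i *\<^sub>R W i)"
    by (simp only: norm_triangle_ineq4)
  moreover have "norm (\<Sum>t<L. S t) \<le> real L * (\<bar>b ! j\<bar> / 4)"
    using sum_norm_le[of "{..<L}" S "\<lambda>_. \<bar>b ! j\<bar> / 4"] S by (simp add: less_imp_le)
  moreover have "norm (\<Sum>i\<in>{..<length b} - {j}. b ! i *\<^sub>R W i) \<le> (\<Sum>i\<in>{..<length b} - {j}. \<bar>b ! i\<bar> * 2)"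
    using W by (intro sum_norm_le) (auto intro: mult_left_mono)
  moreover have "(\<Sum>i\<in>{..<length b} - {j}. \<bar>b ! i\<bar> * 2) \<le> (\<Sum>i<length b. \<bar>b ! i\<bar> * 2)"
    by (intro sum_mono2) auto
  moreover have "(\<Sum>i<length b. \<bar>b ! i\<bar> * 2) = 2 * \<beta>" by (simp add: \<beta>_def flip: sum_distrib_right)
  moreover have "\<bar>b ! j\<bar> * (real L * (1/2)) \<le> norm (b ! j *\<^sub>R W j)"
    using Wj by (simp only: norm_scaleR) (rule mult_left_mono, auto)
  ultimately have "\<bar>b ! j\<bar> * (real L * (1/2)) \<le> real L * (\<bar>b ! j\<bar> / 4) + 2 * \<beta>" by linarith
  then show False using L by (simp add: field_simps)
qed

text \<open>
  The consecutive differences along the subsequence behave like a basis with bounded coordinate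
  functionals, as long as the number of terms is bounded and the coefficients come from a fixed
  finite set. The constant \<open>1/4\<close> depends on neither.
\<close>

lemma exists_subsequence_controlling_coefficients:
  fixes y :: "nat \<Rightarrow> 'b::real_normed_vector"
  assumes y: "\<And>n. norm (y n) = 1" and sep: "\<forall>i j. i \<noteq> j \<longrightarrow> 1/2 \<le> norm (y i - y j)"
    and D: "finite D" and M: "infinite M"
  shows "\<exists>e :: nat \<Rightarrow> nat. strict_mono e \<and> range e \<subseteq> M \<and>
    (\<forall>A a j. finite A \<longrightarrow> card A \<le> n \<longrightarrow> a ` A \<subseteq> D \<longrightarrow> j \<in> A \<longrightarrow>
      \<bar>a j\<bar> / 4 \<le> norm (\<Sum>p\<in>A. a p *\<^sub>R (y (e (2 * p)) - y (e (Suc (2 * p))))))"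
proof -
  define I where "I = {b :: real list. set b \<subseteq> D \<and> length b \<le> n} \<times> {..<n}"
  define I' where "I' = {i \<in> I. snd i < length (fst i)}"
  have "finite I'" unfolding I_def I'_def using finite_lists_length_le[OF D, of n] by simp
  moreover have "\<exists>X\<subseteq>M'. finite X \<and> card X = length (difference_pattern (fst i)) \<and>
      \<bar>fst i ! snd i\<bar> / 4 \<le> norm (pattern_sum y (difference_pattern (fst i)) X)"
    if "i \<in> I'" "infinite M'" for i M'
    using exists_large_difference_sum[OF y sep _ that(2)] that(1) by (simp add: I'_def)
  ultimately obtain M' where M': "M' \<subseteq> M" "infinite M'"
    and large: "\<forall>i\<in>I'. \<forall>X\<subseteq>M'. finite X \<and> card X = length (difference_pattern (fst i)) \<longrightarrow>
      \<bar>fst i ! snd i\<bar> / 4 \<le> norm (pattern_sum y (difference_pattern (fst i)) X)"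
    using ramsey_simultaneous[OF _ M, of I' "\<lambda>i. length (difference_pattern (fst i))"
        "\<lambda>i X. \<bar>fst i ! snd i\<bar> / 4 \<le> norm (pattern_sum y (difference_pattern (fst i)) X)"]
    by auto
  define e where "e = enumerate M'"
  have e: "strict_mono e" "\<And>n. e n \<in> M'"
    unfolding e_def using M' by (simp_all add: strict_mono_enumerate enumerate_in_set)
  have "\<bar>a j\<bar> / 4 \<le> norm (\<Sum>p\<in>A. a p *\<^sub>R (y (e (2 * p)) - y (e (Suc (2 * p)))))"
    if A: "finite A" "card A \<le> n" "a ` A \<subseteq> D" "j \<in> A" for A a j
  proof -
    let ?ps = "sorted_list_of_set A"
    define b where "b = map a ?ps"
    have sorted: "?ps ! i < ?ps ! Suc i" if "Suc i < length ?ps" for i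
      using sorted_list_of_set.strict_sorted_key_list_of_set[of A] that
      by (simp add: sorted_wrt_iff_nth_less)
    have "j \<in> set ?ps" using A by simp
    then obtain i where i: "i < length ?ps" "?ps ! i = j" by (auto simp: in_set_conv_nth)
    have "(b, i) \<in> I'" using A i by (auto simp: I'_def I_def b_def)
    have lens: "length b = length ?ps" by (simp add: b_def)
    have "\<exists>X\<subseteq>M'. finite X \<and> card X = length (difference_pattern b) \<and>
      pattern_sum y (difference_pattern b) X =
        (\<Sum>i<length b. b ! i *\<^sub>R (y (e (2 * (?ps ! i))) - y (e (Suc (2 * (?ps ! i))))))"
    proof (rule pattern_sum_difference_pattern)
      fix i assume "Suc i < length b"
      then have "Suc (2 * (?ps ! i)) < 2 * (?ps ! Suc i)" using sorted[of i] lens by simp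
      then show "e (Suc (2 * (?ps ! i))) < e (2 * (?ps ! Suc i))"
        unfolding strict_mono_less[OF e(1)] .
    qed (use e in \<open>simp_all add: strict_mono_less\<close>)
    then obtain X where X: "X \<subseteq> M'" "finite X" "card X = length (difference_pattern b)"
      "pattern_sum y (difference_pattern b) X =
        (\<Sum>i<length b. b ! i *\<^sub>R (y (e (2 * (?ps ! i))) - y (e (Suc (2 * (?ps ! i))))))"
      by blast
    have "\<bar>a j\<bar> / 4 = \<bar>b ! i\<bar> / 4" using i by (simp add: b_def)
    also have "\<dots> \<le> norm (pattern_sum y (difference_pattern b) X)"
      using large[rule_format, of "(b, i)" X] \<open>(b, i) \<in> I'\<close> X(1-3) by simp
    also have "pattern_sum y (difference_pattern b) X =
        pattern_sum (\<lambda>p. y (e (2 * p)) - y (e (Suc (2 * p)))) b A"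
      unfolding X(4) by (simp add: pattern_sum_def)
    also have "\<dots> = (\<Sum>p\<in>A. a p *\<^sub>R (y (e (2 * p)) - y (e (Suc (2 * p)))))"
      unfolding b_def by (rule pattern_sum_map[OF A(1)])
    finally show ?thesis .
  qed
  moreover have "range e \<subseteq> M" using e M' by auto
  ultimately show ?thesis using e(1) by blast
qed

section \<open>Bounded sums of signs\<close>

text \<open>
  Complete the \<open>l\<close> given positions to \<open>length c\<close> positions by adding late ones. Two such choices that
  differ only in the first \<open>l\<close> positions, \<open>2 * p i\<close> and \<open>2 * p i + 1\<close>, have sums of norm at most \<open>R\<close>,
  and the added terms cancel in the difference of the sums.
\<close>

lemma norm_sign_difference_sum_le:
  fixes y :: "nat \<Rightarrow> 'b::real_normed_vector"
  assumes bounded: "\<And>X. X \<subseteq> M \<Longrightarrow> finite X \<Longrightarrow> card X = length c \<Longrightarrow> norm (pattern_sum y c X) \<le> R"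
    and e: "strict_mono e" "range e \<subseteq> M"
    and l: "l \<le> length c" and p: "strict_mono_on {..<l} p"
  shows "norm (\<Sum>i<l. c ! i *\<^sub>R (y (e (2 * p i)) - y (e (Suc (2 * p i))))) \<le> 2 * R"
proof -
  \<comment> \<open>The added positions start beyond all \<open>2 * p i + 1\<close> with \<open>i < l\<close>.\<close>
  define q where "q = 2 * p (l - 1) + 2"
  have *: "norm (\<Sum>i<length c. c ! i *\<^sub>R y (e (h i))) \<le> R"
    if "strict_mono_on {..<length c} h" for h
  proof -
    have mono: "strict_mono_on {..<length c} (\<lambda>i. e (h i))"
      using that e(1) by (simp add: strict_mono_on_def strict_mono_less)
    have "norm (pattern_sum y c ((\<lambda>i. e (h i)) ` {..<length c})) \<le> R"
      using e(2) card_image[OF strict_mono_on_imp_inj_on[OF mono]] by (intro bounded) auto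
    then show ?thesis unfolding pattern_sum_image[OF mono] .
  qed
  define g where "g \<delta> i = (if i < l then 2 * p i + \<delta> else q + i)" for \<delta> i
  have mono: "strict_mono_on {..<length c} (g \<delta>)" if "\<delta> \<le> 1" for \<delta>
  proof (rule strict_mono_on_lessThanI)
    fix i
    consider "Suc i < l" | "Suc i = l" | "\<not> i < l" by linarith
    then show "g \<delta> i < g \<delta> (Suc i)"
    proof cases
      case 1
      then have "p i < p (Suc i)" using p by (simp add: strict_mono_on_def)
      then show ?thesis using 1 that by (simp add: g_def)
    next
      case 2
      then have "l - 1 = i" by simp
      then show ?thesis using 2 that by (simp add: g_def q_def)
    qed (simp add: g_def)
  qed
  have "(\<Sum>i<l. c ! i *\<^sub>R (y (e (2 * p i)) - y (e (Suc (2 * p i)))))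
      = (\<Sum>i<length c. c ! i *\<^sub>R (y (e (g 0 i)) - y (e (g 1 i))))"
    using l by (intro sum.mono_neutral_cong_left) (auto simp: g_def)
  also have "\<dots> = (\<Sum>i<length c. c ! i *\<^sub>R y (e (g 0 i))) - (\<Sum>i<length c. c ! i *\<^sub>R y (e (g 1 i)))"
    by (simp add: scaleR_diff_right sum_subtractf)
  also have "norm \<dots> \<le> R + R"
    using *[OF mono[of 0]] *[OF mono[of 1]] by (intro norm_triangle_le_diff) simp
  finally show ?thesis by simp
qed

text \<open>
  Here the differences \<open>z\<close> behave like the unit vectors of \<open>c0\<close>, up to the signs \<open>c\<close>, and the
  embedding is modelled on an embedding of the tree into \<open>c0\<close>: a list of length \<open>l\<close> is sent to the
  sum of its prefix vectors, the prefix of length \<open>i + 1\<close> having the coefficient \<open>(l - i) * c ! i\<close>.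
  A step to a child adds one sum of signs along a branch, which is bounded. Conversely, the
  prefix just beyond the meet of two lists has in the difference a coefficient of absolute value
  the distance to the meet, and the norm controls coefficients.
\<close>

lemma embeddings_if_sign_sums_bounded:
  fixes y :: "nat \<Rightarrow> 'b::real_normed_vector"
  assumes y: "\<And>n. norm (y n) = 1" and sep: "\<forall>i j. i \<noteq> j \<longrightarrow> 1/2 \<le> norm (y i - y j)"
    and R: "R \<ge> 0"
    and bounded: "\<And>k. \<exists>c M. k \<le> length c \<and> set c \<subseteq> {-1, 1} \<and> infinite M \<and>
      (\<forall>X\<subseteq>M. finite X \<and> card X = length c \<longrightarrow> norm (pattern_sum y c X) \<le> R)"
  shows "coarse_list_tree_embeddings TYPE('b)"
  unfolding coarse_list_tree_embeddings_def
proof (intro exI[of _ "2 * R"] exI[of _ "\<lambda>N. 8 * N"] conjI allI)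
  show "0 \<le> 2 * R" using R by simp
  fix k :: nat
  obtain c M where c: "k \<le> length c" "set c \<subseteq> {-1, 1}" and M: "infinite M"
    and cM: "\<And>X. X \<subseteq> M \<Longrightarrow> finite X \<Longrightarrow> card X = length c \<Longrightarrow> norm (pattern_sum y c X) \<le> R"
    using bounded[of k] by blast
  \<comment> \<open>A finite set that contains all coefficients of differences of two images.\<close>
  define D where "D = {x :: real. x \<in> \<int> \<and> \<bar>x\<bar> \<le> 2 * real k}"
  have "finite D" unfolding D_def by (rule finite_abs_int_segment)
  from exists_subsequence_controlling_coefficients[where y = y and n = "2 * k", OF y sep this M]
  obtain e where e: "strict_mono e" "range e \<subseteq> M"
    and coeff: "\<forall>A a j. finite A \<longrightarrow> card A \<le> 2 * k \<longrightarrow> a ` A \<subseteq> D \<longrightarrow> j \<in> A \<longrightarrow>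
      \<bar>a j\<bar> / 4 \<le> norm (\<Sum>p\<in>A. a p *\<^sub>R (y (e (2 * p)) - y (e (Suc (2 * p)))))"
    by (elim exE conjE)
  define z where "z p = y (e (2 * p)) - y (e (Suc (2 * p)))" for p
  define w where "w xs s = (if s \<in> nonempty_prefixes xs
      then real (Suc (length xs) - length s) * c ! (length s - 1) else 0)" for xs s :: "nat list"
  define F where "F xs = (\<Sum>s\<in>nonempty_prefixes xs. w xs s *\<^sub>R z (list_encode s))" for xs
  have F_nth: "F xs = (\<Sum>i<length xs. (real (length xs - i) * c ! i) *\<^sub>R z (list_encode (take (Suc i) xs)))"
    for xs
    unfolding F_def nonempty_prefixes_eq_image sum.reindex[OF inj_on_take_Suc]
    by (intro sum.cong) (auto simp: w_def nonempty_prefixes_eq_image)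
  have step: "norm (F (xs @ [x]) - F xs) \<le> 2 * R" if "length xs < k" for xs x
  proof -
    let ?l = "Suc (length xs)"
    let ?z = "\<lambda>i. z (list_encode (take (Suc i) (xs @ [x])))"
    have "F xs = (\<Sum>i<?l. (real (length xs - i) * c ! i) *\<^sub>R ?z i)"
      unfolding F_nth by simp
    moreover have "F (xs @ [x]) = (\<Sum>i<?l. (real (?l - i) * c ! i) *\<^sub>R ?z i)"
      unfolding F_nth by simp
    ultimately have "F (xs @ [x]) - F xs
        = (\<Sum>i<?l. (real (?l - i) * c ! i) *\<^sub>R ?z i - (real (length xs - i) * c ! i) *\<^sub>R ?z i)"
      by (simp only: sum_subtractf)
    also have "\<dots> = (\<Sum>i<?l. c ! i *\<^sub>R ?z i)"
      by (intro sum.cong refl) (auto simp: of_nat_diff algebra_simps simp flip: scaleR_diff_left)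
    also have "norm \<dots> \<le> 2 * R"
      unfolding z_def using that c(1) strict_mono_on_list_encode_take[of "xs @ [x]"]
      by (intro norm_sign_difference_sum_le[OF cM e]) auto
    finally show ?thesis .
  qed
  have path: "norm (F (us @ vs) - F us) \<le> 2 * R * real (length vs)" if "length (us @ vs) \<le> k" for us vs
    using that
  proof (induction vs rule: rev_induct)
    case (snoc v vs)
    have "F (us @ vs @ [v]) - F us = (F ((us @ vs) @ [v]) - F (us @ vs)) + (F (us @ vs) - F us)" by simp
    also have "norm \<dots> \<le> 2 * R + 2 * R * real (length vs)"
      using snoc step[of "us @ vs" v] by (intro norm_triangle_mono) auto
    finally show ?case by (simp add: algebra_simps)
  qed simp
  have upper: "norm (F xs - F ys) \<le> 2 * R * real (list_tree_dist xs ys)"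
    if len: "length xs \<le> k" "length ys \<le> k" for xs ys
  proof -
    let ?us = "longest_common_prefix xs ys"
    obtain vs ws where vs: "xs = ?us @ vs" and ws: "ys = ?us @ ws"
      using longest_common_prefix_prefix1 longest_common_prefix_prefix2 by (metis prefix_def)
    have "length xs = length ?us + length vs" "length ys = length ?us + length ws"
      using arg_cong[OF vs, of length] arg_cong[OF ws, of length] by simp_all
    then have d: "list_tree_dist xs ys = length vs + length ws" by (simp add: list_tree_dist_def)
    have "F xs - F ys = (F xs - F ?us) - (F ys - F ?us)" by simp
    also have "norm \<dots> \<le> norm (F xs - F ?us) + norm (F ys - F ?us)" by (rule norm_triangle_ineq4)
    also have "\<dots> \<le> 2 * R * real (length vs) + 2 * R * real (length ws)"
      using path[of ?us vs] path[of ?us ws] len vs ws by (intro add_mono) auto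
    finally show ?thesis by (simp add: d distrib_left)
  qed
  have c1: "c ! i \<in> \<int> \<and> \<bar>c ! i\<bar> = 1" if "i < k" for i
  proof -
    have "c ! i \<in> {-1, 1}" using that c by (meson nth_mem order_less_le_trans subsetD)
    then show ?thesis by auto
  qed
  have w: "w xs s \<in> \<int> \<and> \<bar>w xs s\<bar> \<le> real k" if len: "length xs \<le> k" for xs s
  proof (cases "s \<in> nonempty_prefixes xs")
    case True
    then have "0 < length s" "length s \<le> length xs"
      by (auto simp: nonempty_prefixes_def prefix_length_le)
    then have i: "length s - 1 < k" "Suc (length xs) - length s \<le> k" using len by linarith+
    then have "\<bar>w xs s\<bar> = real (Suc (length xs) - length s)"
      using c1[OF i(1)] True by (simp add: w_def abs_mult)
    moreover have "w xs s \<in> \<int>" using c1[OF i(1)] True by (simp add: w_def)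
    ultimately show ?thesis using i(2) by simp
  qed (simp add: w_def)
  have lower: "real (length xs - length (longest_common_prefix xs ys)) / 4 \<le> norm (F xs - F ys)"
    if len: "length xs \<le> k" "length ys \<le> k" for xs ys
  proof (cases "length (longest_common_prefix xs ys) < length xs")
    case True
    let ?j = "length (longest_common_prefix xs ys)"
    \<comment> \<open>The first prefix of \<open>xs\<close> beyond the meet.\<close>
    define s where "s = take (Suc ?j) xs"
    define P where "P = nonempty_prefixes xs \<union> nonempty_prefixes ys"
    define a where "a p = w xs (list_decode p) - w ys (list_decode p)" for p
    have s: "s \<in> nonempty_prefixes xs" "length s = Suc ?j"
      using True unfolding s_def nonempty_prefixes_def by (auto simp: take_is_prefix)
    have "s \<notin> nonempty_prefixes ys"
    proof
      assume "s \<in> nonempty_prefixes ys"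
      with s(1) have "s \<in> nonempty_prefixes (longest_common_prefix xs ys)"
        using nonempty_prefixes_Int by blast
      then show False using s(2) prefix_length_le by (fastforce simp: nonempty_prefixes_def)
    qed
    then have "a (list_encode s) = w xs s" by (simp add: a_def w_def)
    also have "\<bar>\<dots>\<bar> = real (length xs - ?j)"
      using s c1[of ?j] True len by (simp add: w_def abs_mult)
    finally have as: "\<bar>a (list_encode s)\<bar> = real (length xs - ?j)" by simp
    have finP: "finite P" by (simp add: P_def)
    have "F xs = (\<Sum>s\<in>P. w xs s *\<^sub>R z (list_encode s))"
      unfolding F_def using finP by (intro sum.mono_neutral_left) (auto simp: P_def w_def)
    moreover have "F ys = (\<Sum>s\<in>P. w ys s *\<^sub>R z (list_encode s))"
      unfolding F_def using finP by (intro sum.mono_neutral_left) (auto simp: P_def w_def)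
    ultimately have "F xs - F ys = (\<Sum>s\<in>P. a (list_encode s) *\<^sub>R z (list_encode s))"
      by (simp add: a_def scaleR_diff_left sum_subtractf)
    also have "\<dots> = (\<Sum>p\<in>list_encode ` P. a p *\<^sub>R z p)"
      by (simp add: sum.reindex[OF inj_list_encode])
    finally have eq: "F xs - F ys = (\<Sum>p\<in>list_encode ` P. a p *\<^sub>R z p)" .
    have "card P \<le> 2 * k"
      using card_Un_le[of "nonempty_prefixes xs" "nonempty_prefixes ys"] len by (simp add: P_def)
    then have cardP: "card (list_encode ` P) \<le> 2 * k" using card_image_le[OF finP] le_trans by blast
    have range: "a p \<in> \<int> \<and> \<bar>a p\<bar> \<le> 2 * real k" for p
      using w[OF len(1), of "list_decode p"] w[OF len(2), of "list_decode p"]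
      by (auto simp: a_def)
    have "\<bar>a (list_encode s)\<bar> / 4 \<le> norm (\<Sum>p\<in>list_encode ` P. a p *\<^sub>R z p)"
      unfolding z_def using finP cardP range s(1)
      by (intro coeff[rule_format]) (auto simp: P_def D_def)
    then show ?thesis using as eq by simp
  qed simp
  have "real N \<le> norm (F xs - F ys)"
    if len: "length xs \<le> k" "length ys \<le> k" and N: "8 * N \<le> list_tree_dist xs ys" for xs ys N
  proof -
    let ?j = "length (longest_common_prefix xs ys)"
    have "4 * N \<le> length xs - ?j \<or> 4 * N \<le> length ys - ?j"
      using N unfolding list_tree_dist_def by linarith
    then have "4 * real N \<le> real (length xs - ?j) \<or> 4 * real N \<le> real (length ys - ?j)"
      by (metis of_nat_le_iff of_nat_mult of_nat_numeral)
    then show ?thesis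
      using lower[OF len] lower[OF len(2,1)]
      by (auto simp: longest_common_prefix_commute[of ys xs] norm_minus_commute[of "F ys"])
  qed
  with upper show "\<exists>F :: nat list \<Rightarrow> 'b. \<forall>xs ys. length xs \<le> k \<longrightarrow> length ys \<le> k \<longrightarrow>
      norm (F xs - F ys) \<le> 2 * R * real (list_tree_dist xs ys) \<and>
      (\<forall>N. 8 * N \<le> list_tree_dist xs ys \<longrightarrow> real N \<le> norm (F xs - F ys))"
    by blast
qed

section \<open>The dichotomy and the equivalence\<close>

text \<open>
  Either some constant bounds, for arbitrarily long sign patterns, all sums with this pattern along
  some infinite set of positions, or no constant does. The failure of the first alternative at a constant \<open>R\<close>
  provides exactly the threshold \<open>T R\<close> of the second one.
\<close>

lemma coarse_list_tree_embeddings_infinite_dimensional: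
  assumes "\<And>B :: 'b::real_normed_vector set. finite B \<Longrightarrow> span B \<noteq> UNIV"
  shows "coarse_list_tree_embeddings TYPE('b)"
proof -
  obtain y :: "nat \<Rightarrow> 'b" where y: "\<And>n. norm (y n) = 1"
    and sep: "\<forall>i j. i \<noteq> j \<longrightarrow> 1/2 \<le> norm (y i - y j)"
    using exists_separated_unit_sequence[OF assms] by blast
  show ?thesis
  proof (cases "\<exists>R\<ge>0. \<forall>k. \<exists>c M. k \<le> length c \<and> set c \<subseteq> {-1, 1} \<and> infinite M \<and>
      (\<forall>X\<subseteq>M. finite X \<and> card X = length c \<longrightarrow> norm (pattern_sum y c X) \<le> R)")
    case True
    then obtain R where R: "R \<ge> 0" "\<And>k. \<exists>c M. k \<le> length c \<and> set c \<subseteq> {-1, 1} \<and> infinite M \<and>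
      (\<forall>X\<subseteq>M. finite X \<and> card X = length c \<longrightarrow> norm (pattern_sum y c X) \<le> R)" by blast
    show ?thesis by (rule embeddings_if_sign_sums_bounded[where y = y, OF y sep R])
  next
    case False
    have "\<forall>R :: nat. \<exists>k. \<forall>c M. k \<le> length c \<longrightarrow> set c \<subseteq> {-1, 1} \<longrightarrow> infinite M \<longrightarrow>
      (\<exists>X\<subseteq>M. finite X \<and> card X = length c \<and> real R \<le> norm (pattern_sum y c X))"
    proof
      fix R :: nat
      have "\<not> (\<forall>k. \<exists>c M. k \<le> length c \<and> set c \<subseteq> {-1, 1} \<and> infinite M \<and>
        (\<forall>X\<subseteq>M. finite X \<and> card X = length c \<longrightarrow> norm (pattern_sum y c X) \<le> real R))"
        using False of_nat_0_le_iff[of R] by blast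
      then show "\<exists>k. \<forall>c M. k \<le> length c \<longrightarrow> set c \<subseteq> {-1, 1} \<longrightarrow> infinite M \<longrightarrow>
        (\<exists>X\<subseteq>M. finite X \<and> card X = length c \<and> real R \<le> norm (pattern_sum y c X))"
        by (meson linear)
    qed
    from choice[OF this] obtain T where "\<forall>R c M. T R \<le> length c \<longrightarrow> set c \<subseteq> {-1, 1} \<longrightarrow> infinite M \<longrightarrow>
      (\<exists>X\<subseteq>M. finite X \<and> card X = length c \<and> real R \<le> norm (pattern_sum y c X))" by blast
    then show ?thesis by (intro embeddings_if_sign_sums_unbounded[where y = y and T = T, OF y]) blast
  qed
qed

lemma finite_dimensional_iff_finite_span:
  "(\<exists>B :: 'b::real_vector set. finite_dimensional_vector_space scaleR B)
    \<longleftrightarrow> (\<exists>B :: 'b set. finite B \<and> span B = UNIV)"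
proof
  assume "\<exists>B :: 'b set. finite_dimensional_vector_space scaleR B"
  then obtain B :: "'b set" where "finite_dimensional_vector_space scaleR B" by blast
  then show "\<exists>B :: 'b set. finite B \<and> span B = UNIV"
    unfolding span_raw_def
    using finite_dimensional_vector_space.finite_Basis finite_dimensional_vector_space.span_Basis
    by blast
next
  assume "\<exists>B :: 'b set. finite B \<and> span B = UNIV"
  then obtain B :: "'b set" where B: "finite B" "span B = UNIV" by blast
  obtain C where C: "C \<subseteq> B" "independent C" "B \<subseteq> span C"
    using maximal_independent_subset[of B] by blast
  have "span C = UNIV" using C B by (metis span_mono span_span top.extremum_uniqueI)
  moreover have "finite C" using B C finite_subset by blast
  ultimately have "finite_dimensional_vector_space scaleR C"
    using C(2) unfolding span_raw_def dependent_raw_def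
    by unfold_locales (auto simp: algebra_simps)
  then show "\<exists>B :: 'b set. finite_dimensional_vector_space scaleR B" by blast
qed

theorem theoremE:
  shows "(\<exists>B :: 'b::banach set. finite_dimensional_vector_space scaleR B)
    \<longleftrightarrow> \<not> equi_coarsely_embeds {1..} branching_tree (euclidean_metric :: 'b metric)"
  unfolding finite_dimensional_iff_finite_span
  using not_equi_coarsely_embeds_finite_span
    equi_coarsely_embedsI[OF coarse_list_tree_embeddings_infinite_dimensional]
  by blast

end
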